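(* Let $m=2h+1\ge 5$ be odd and let $f_3(x)=x+x^3+x^{2^{h+1}+1}\in\mathbb{F}_{2^m}[x]$. Let $s^\infty$ be the sequence $s_t=\operatorname{Tr}(f_3(\alpha^t+1))$, $t\ge0$. Then the binary cyclic code $\mathcal{C}_s$ has parameters $[2^m-1,\,2^m-2-3m,\,8]$ and generator polynomial $$g_s(x)=(x-1)\,m_{\alpha^{-1}}(x)\,m_{\alpha^{-3}}(x)\,m_{\alpha^{-(2^h+1)}}(x).$$
   Context: Let $m\ge 1$, $v=2^m-1$, $\alpha$ a primitive element of $\mathbb{F}_{2^m}$, and $\operatorname{Tr}(x)=\sum_{i=0}^{m-1}x^{2^i}$ the absolute trace from $\mathbb{F}_{2^m}$ to $\mathbb{F}_2$. For a polynomial $F$ over $\mathbb{F}_{2^m}$ the binary sequence $s^\infty=(s_t)_{t\ge0}$ is defined by $s_t=\operatorname{Tr}(F(\alpha^t+1))$; it is periodic with period dividing $v$. Its minimal polynomial $g_s(x)$ is the polynomial $1+c_1x+\dots+c_Lx^L\in\mathbb{F}_2[x]$ of least degree $L$ such that $s_i+c_1s_{i-1}+\dots+c_Ls_{i-L}=0$ for all $i\ge L$; its degree $L_s$ is the linear span of $s^\infty$. $\mathcal{C}_s$ denotes the binary cyclic code of length $v$ with generator polynomial $g_s(x)$ (so $\dim\mathcal{C}_s=v-L_s$). For an integer $i$, $m_{\alpha^i}(x)$ is the minimal polynomial of $\alpha^i$ over $\mathbb{F}_2$. $[n,k,d]$ denotes length, dimension, minimum Hamming distance. *)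

theory Defs
  imports "HOL-Computational_Algebra.Polynomial" "HOL-Library.Z2"
begin

text \<open>Binary field F_2 is the type bit. Elements of F_{2^m} live in a finite field type 'a
  with CARD('a) = 2^m.\<close>

definition embed_bit :: "bit \<Rightarrow> 'a::field" where
  "embed_bit b = (if b = 0 then 0 else 1)"

definition trace2 :: "nat \<Rightarrow> 'a::field \<Rightarrow> 'a" where
  "trace2 m x = (\<Sum>i<m. x ^ (2 ^ i))"

definition primitive_elem :: "'a::{field,finite} \<Rightarrow> bool" where
  "primitive_elem a \<longleftrightarrow> a \<noteq> 0 \<and> (\<forall>x::'a. x \<noteq> 0 \<longrightarrow> (\<exists>k::nat. x = a ^ k))"

definition trace_seq :: "nat \<Rightarrow> ('a::field \<Rightarrow> 'a) \<Rightarrow> 'a \<Rightarrow> nat \<Rightarrow> bit" where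
  "trace_seq m F a t = (if trace2 m (F (a ^ t + 1)) = 0 then 0 else 1)"

definition seq_annihilates :: "bit poly \<Rightarrow> (nat \<Rightarrow> bit) \<Rightarrow> bool" where
  "seq_annihilates g s \<longleftrightarrow> coeff g 0 = 1 \<and>
     (\<forall>i\<ge>degree g. (\<Sum>j\<le>degree g. coeff g j * s (i - j)) = 0)"

definition seq_min_poly :: "(nat \<Rightarrow> bit) \<Rightarrow> bit poly" where
  "seq_min_poly s = (THE g. seq_annihilates g s \<and>
      (\<forall>g'. seq_annihilates g' s \<longrightarrow> degree g \<le> degree g'))"

definition linear_span :: "(nat \<Rightarrow> bit) \<Rightarrow> nat" where
  "linear_span s = degree (seq_min_poly s)"

definition min_poly_F2 :: "'a::field \<Rightarrow> bit poly" where
  "min_poly_F2 b = (THE p. lead_coeff p = 1 \<and> poly (map_poly embed_bit p) b = 0 \<and>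
      (\<forall>q. q \<noteq> 0 \<and> poly (map_poly embed_bit q) b = 0 \<longrightarrow> degree p \<le> degree q))"

definition cyclic_code :: "nat \<Rightarrow> bit poly \<Rightarrow> bit poly set" where
  "cyclic_code n g = {c. degree c < n \<and> g dvd c}"

definition hweight :: "bit poly \<Rightarrow> nat" where
  "hweight c = card {i. coeff c i \<noteq> 0}"

definition code_dim :: "bit poly set \<Rightarrow> nat" where
  "code_dim C = (THE k. card C = 2 ^ k)"

definition min_dist :: "bit poly set \<Rightarrow> nat" where
  "min_dist C = Min (hweight ` (C - {0}))"

end

theory Submission
  imports Defs "HOL-Computational_Algebra.Primes"
begin

text \<open>
  Expanding \<open>f\<^sub>3(\<alpha>\<^sup>t + 1)\<close> under the trace gives
  \<open>s\<^sub>t = 1 + Tr(\<alpha>\<^sup>t) + Tr(\<alpha>\<^bsup>3t\<^esup>) + Tr(\<alpha>\<^bsup>(2^h+1)t\<^esup>)\<close>, a sum of \<open>3m + 1\<close> distinct geometric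
  sequences; a polynomial annihilates it iff it vanishes at the inverses of their ratios.

  Codewords correspond to sets \<open>S\<close> of nonzero field elements of even size with
  \<open>\<Sum>x = \<Sum>x\<sigma>(x) = \<Sum>x\<^sup>3 = 0\<close>, where \<open>\<sigma>(x) = x\<^bsup>2^(h+1)\<^esup>\<close> satisfies \<open>\<sigma>(\<sigma>(x)) = x\<^sup>2\<close>. These
  conditions say that the vectors \<open>(x)\<close>, \<open>(\<sigma>(x))\<close>, \<open>(\<sigma>\<^sup>2(x))\<close> indexed by \<open>S\<close> are pairwise and self
  orthogonal, and they are invariant under translation. If \<open>|S| = 6\<close>, translate one point to 0;
  the remaining five points give three mutually orthogonal isotropic vectors in a space of
  dimension 5, so they are dependent, and the five points lie in the kernel of a
  \<open>\<sigma>\<close>-polynomial of degree 2, which has only three nonzero elements. Sizes 2 and 4 are similar.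
  Since the conditions are quadratic over \<open>F\<^sub>2\<close>, every 3-dimensional affine flat avoiding 0 is a
  codeword of weight 8.
\<close>

section \<open>Arithmetic in characteristic 2 and powers of Frobenius\<close>

lemma add_self_CHAR_2:
  fixes x :: "'a::ring_1"
  assumes "CHAR('a) = 2"
  shows "x + x = 0"
  using uminus_CHAR_2[OF assms, of x] by (metis add.right_inverse)

lemma add_eq_0_iff_CHAR_2:
  fixes x y :: "'a::ring_1"
  assumes "CHAR('a) = 2"
  shows "x + y = 0 \<longleftrightarrow> x = y"
  using uminus_CHAR_2[OF assms, of y] by (metis add_eq_0_iff2)

text \<open>Multiplication by \<open>x\<close> permutes the nonzero elements, so their product can
  be cancelled.\<close>

lemma finite_field_power_card:
  fixes x :: "'a::{field,finite}"
  assumes "x \<noteq> 0"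
  shows "x ^ (card (UNIV :: 'a set) - 1) = 1"
proof -
  have "(\<Prod>y\<in>UNIV-{0}. x * y) = (\<Prod>y\<in>UNIV-{0}. y)"
    by (rule prod.reindex_bij_witness[of _ "\<lambda>y. y / x" "\<lambda>y. x * y"]) (use assms in auto)
  then have "x ^ (card (UNIV :: 'a set) - 1) * \<Prod>(UNIV-{0}) = \<Prod>(UNIV-{0})"
    by (simp add: prod.distrib)
  then show ?thesis
    by simp
qed

text \<open>The power of -1 with the odd exponent \<open>2 ^ m - 1\<close> equals 1, hence -1 =
  1.\<close>

lemma CHAR_2_if_card_eq_power_2:
  assumes "card (UNIV :: 'a::{field,finite} set) = 2 ^ m" and "m > 0"
  shows "CHAR('a) = 2"
proof -
  have "(-1::'a) ^ (2 ^ m - 1) = 1"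
    using finite_field_power_card[of "-1::'a"] assms(1) by simp
  moreover have "odd (2 ^ m - 1 :: nat)"
    using assms(2) by simp
  ultimately have "(-1::'a) = 1"
    by simp
  then have "of_nat 2 = (0::'a)"
    by (metis add.right_inverse of_nat_numeral one_add_one)
  then have "CHAR('a) dvd 2"
    by (simp only: of_nat_eq_0_iff_char_dvd)
  moreover have "CHAR('a) \<noteq> 1"
    by simp
  ultimately show ?thesis
    by (metis prime_nat_iff two_is_prime_nat)
qed

lemma power_2_power_add:
  fixes x y :: "'a::comm_semiring_1"
  assumes "CHAR('a) = 2"
  shows "(x + y) ^ (2 ^ k) = x ^ (2 ^ k) + y ^ (2 ^ k)"
  using freshmans_dream'[where 'a='a, of "2^k" k x y] assms by simp

lemma power_2_power_sum:
  fixes f :: "'b \<Rightarrow> 'a::comm_semiring_1"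
  assumes "CHAR('a) = 2"
  shows "sum f A ^ (2 ^ k) = (\<Sum>i\<in>A. f i ^ (2 ^ k))"
  using freshmans_dream_sum'[where 'a='a, of "2^k" k f A] assms by simp

lemma power_2_power_inj:
  fixes x y :: "'a::field"
  assumes "CHAR('a) = 2" and "x ^ (2 ^ k) = y ^ (2 ^ k)"
  shows "x = y"
proof -
  have "(x + y) ^ (2 ^ k) = 0"
    using assms by (simp add: power_2_power_add add_self_CHAR_2)
  then show ?thesis
    using assms(1) by (simp add: add_eq_0_iff_CHAR_2)
qed

section \<open>Binary polynomials evaluated in an extension field\<close>

definition eval2 :: "bit poly \<Rightarrow> 'a::field \<Rightarrow> 'a" where
  "eval2 p x = poly (map_poly embed_bit p) x"

lemma embed_bit_simps [simp]: "embed_bit 0 = 0" "embed_bit 1 = 1"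
  by (simp_all add: embed_bit_def)

lemma embed_bit_eq_0_iff [simp]: "embed_bit b = 0 \<longleftrightarrow> b = 0"
  by (simp add: embed_bit_def)

lemma embed_bit_add:
  assumes "CHAR('a::field) = 2"
  shows "(embed_bit (a + b) :: 'a) = embed_bit a + embed_bit b"
  using add_self_CHAR_2[OF assms, of 1] by (cases a; cases b) simp_all

lemma embed_bit_mult: "embed_bit (a * b) = embed_bit a * embed_bit b"
  by (cases a; cases b) auto

lemma embed_bit_sum:
  assumes "CHAR('a::field) = 2"
  shows "(embed_bit (sum f A) :: 'a) = (\<Sum>i\<in>A. embed_bit (f i))"
  by (induction A rule: infinite_finite_induct)
    (simp_all add: embed_bit_add[OF assms] del: add_bit_eq_xor)

lemma coeff_map_poly_embed_bit [simp]:
  "coeff (map_poly embed_bit p) i = embed_bit (coeff p i)"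
  by (simp add: coeff_map_poly)

lemma degree_map_poly_embed_bit [simp]: "degree (map_poly embed_bit p) = degree p"
  by (rule degree_map_poly) simp

lemma eval2_altdef: "eval2 p x = (\<Sum>i\<le>degree p. embed_bit (coeff p i) * x ^ i)"
  by (simp add: eval2_def poly_altdef)

lemma eval2_eq_sum_support: "eval2 p x = (\<Sum>i | coeff p i \<noteq> 0. x ^ i)"
proof -
  have "(\<Sum>i\<le>degree p. embed_bit (coeff p i) * x ^ i) = (\<Sum>i | coeff p i \<noteq> 0. x ^ i)"
    by (rule sum.mono_neutral_cong_right)
      (auto simp: embed_bit_def intro: le_degree simp del: bit_not_zero_iff bit_not_one_iff)
  then show ?thesis
    by (simp add: eval2_altdef)
qed

lemma eval2_add:
  assumes "CHAR('a::field) = 2"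
  shows "eval2 (p + q) (x::'a) = eval2 p x + eval2 q x"
proof -
  have "map_poly embed_bit (p + q) = (map_poly embed_bit p + map_poly embed_bit q :: 'a poly)"
    by (rule poly_eqI) (simp add: embed_bit_add[OF assms] del: add_bit_eq_xor)
  then show ?thesis
    by (simp add: eval2_def)
qed

lemma eval2_mult:
  assumes "CHAR('a::field) = 2"
  shows "eval2 (p * q) (x::'a) = eval2 p x * eval2 q x"
proof -
  have "map_poly embed_bit (p * q) = (map_poly embed_bit p * map_poly embed_bit q :: 'a poly)"
    by (rule poly_eqI)
      (simp add: coeff_mult embed_bit_sum[OF assms] embed_bit_mult
        del: add_bit_eq_xor mult_bit_eq_and)
  then show ?thesis
    by (simp add: eval2_def)
qed

text \<open>Frobenius is additive and fixes coefficients in F_2, so the roots of a binary polynomial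
  come in full conjugacy classes.\<close>

lemma eval2_power_2_power:
  assumes "CHAR('a::field) = 2"
  shows "eval2 p ((x::'a) ^ (2 ^ k)) = eval2 p x ^ (2 ^ k)"
  by (simp add: eval2_eq_sum_support power_2_power_sum[OF assms] mult.commute flip: power_mult)

lemma card_le_degree_if_eval2_eq_0:
  fixes A :: "'a::{field,finite} set"
  assumes "p \<noteq> 0" and "\<And>x. x \<in> A \<Longrightarrow> eval2 p x = 0"
  shows "card A \<le> degree p"
proof -
  have "map_poly embed_bit p \<noteq> (0 :: 'a poly)"
    using assms(1) by (simp add: map_poly_eq_0_iff)
  from card_poly_roots_bound[OF this]
  have "card {x. eval2 p x = (0::'a)} \<le> degree p"
    by (simp add: eval2_def)
  moreover have "A \<subseteq> {x. eval2 p x = 0}"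
    using assms(2) by blast
  ultimately show ?thesis
    by (meson card_mono finite le_trans)
qed

text \<open>Serves both to count binary polynomials and to build a codeword with a prescribed
  support.\<close>

lemma bij_betw_support_bit_poly:
  assumes "n > 0"
  shows "bij_betw (\<lambda>p :: bit poly. {i. coeff p i \<noteq> 0}) {p. degree p < n} (Pow {..<n})"
proof (rule bij_betw_byWitness[where f' = "\<lambda>A. Poly (map (\<lambda>i. of_bool (i \<in> A)) [0..<n])"])
  let ?f = "\<lambda>A. Poly (map (\<lambda>i. of_bool (i \<in> A)) [0..<n]) :: bit poly"
  have c: "coeff (?f A) i = of_bool (i \<in> A \<and> i < n)" for A i
    by (simp add: nth_default_def)
  show "\<forall>A\<in>Pow {..<n}. {i. coeff (?f A) i \<noteq> 0} = A"
    by (auto simp: c simp del: bit_not_zero_iff coeff_Poly_eq)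
  show "\<forall>p\<in>{p. degree p < n}. ?f {i. coeff p i \<noteq> 0} = p"
  proof (intro ballI poly_eqI)
    fix p :: "bit poly" and i assume "p \<in> {p. degree p < n}"
    then show "coeff (?f {i. coeff p i \<noteq> 0}) i = coeff p i"
      unfolding c by (cases "coeff p i"; cases "i < n") (auto simp: coeff_eq_0)
  qed
  show "?f ` Pow {..<n} \<subseteq> {p. degree p < n}"
    using assms by (auto simp: c intro!: degree_lessI simp del: coeff_Poly_eq)
  show "(\<lambda>p. {i. coeff p i \<noteq> 0}) ` {p. degree p < n} \<subseteq> Pow {..<n}"
    by (auto simp del: bit_not_zero_iff dest: le_degree)
qed

lemma card_bit_poly_degree_less:
  assumes "n > 0"
  shows "card {p :: bit poly. degree p < n} = 2 ^ n"
  using bij_betw_same_card[OF bij_betw_support_bit_poly[OF assms]] by (simp add: card_Pow)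

lemma finite_bit_poly_degree_less: "finite {p :: bit poly. degree p < n}"
proof (cases "n > 0")
  case True
  then show ?thesis
    using bij_betw_finite[OF bij_betw_support_bit_poly] by simp
qed simp

section \<open>Minimal polynomials\<close>

lemma eval2_diff:
  assumes "CHAR('a::field) = 2"
  shows "eval2 (p - q) (x::'a) = eval2 p x - eval2 q x"
  using eval2_add[OF assms, of "p - q" q x] by (simp add: eq_diff_eq)

text \<open>Pigeonhole: there are \<open>2 ^ (m + 1)\<close> binary polynomials of degree at most
  \<open>m\<close>, but only \<open>2 ^ m\<close> possible values at \<open>b\<close>. The
  difference of two that collide vanishes at \<open>b\<close>.\<close>

lemma ex_bit_poly_root_degree_le:
  fixes b :: "'a::{field,finite}"
  assumes "card (UNIV :: 'a set) = 2 ^ m" and "CHAR('a) = 2"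
  shows "\<exists>q. q \<noteq> 0 \<and> degree q \<le> m \<and> eval2 q b = 0"
proof -
  have "\<not> inj_on (\<lambda>p. eval2 p b) {p. degree p < Suc m}"
  proof
    assume "inj_on (\<lambda>p. eval2 p b) {p. degree p < Suc m}"
    then have "card {p :: bit poly. degree p < Suc m} \<le> card (UNIV :: 'a set)"
      by (rule card_inj_on_le) auto
    then show False
      unfolding assms(1) by (subst (asm) card_bit_poly_degree_less) auto
  qed
  then obtain p q where pq: "degree p < Suc m" "degree q < Suc m" "eval2 p b = eval2 q b" "p \<noteq> q"
    by (auto simp: inj_on_def)
  then have "p - q \<noteq> 0" "degree (p - q) \<le> m" "eval2 (p - q) b = 0"
    using degree_diff_le_max[of p q] by (auto simp: eval2_diff[OF assms(2)])
  then show ?thesis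
    by blast
qed

text \<open>The description by \<open>THE\<close> needs existence and uniqueness. The polynomial
  \<open>q0\<close> shows that an annihilator exists; two monic ones of least degree have a
  difference of smaller degree that again vanishes at \<open>b\<close>, so they coincide.\<close>

lemma min_poly_F2_props:
  fixes b :: "'a::field"
  assumes "CHAR('a) = 2" and "q0 \<noteq> 0" and "eval2 q0 b = 0"
  shows "lead_coeff (min_poly_F2 b) = 1" "eval2 (min_poly_F2 b) b = 0"
    "\<And>q. q \<noteq> 0 \<Longrightarrow> eval2 q b = 0 \<Longrightarrow> degree (min_poly_F2 b) \<le> degree q"
proof -
  let ?P = "\<lambda>p. lead_coeff p = 1 \<and> eval2 p b = 0 \<and>
      (\<forall>q. q \<noteq> 0 \<and> eval2 q b = 0 \<longrightarrow> degree p \<le> degree q)"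
  obtain p where p: "p \<noteq> 0" "eval2 p b = 0" "\<And>q. q \<noteq> 0 \<Longrightarrow> eval2 q b = 0 \<Longrightarrow> degree p \<le> degree q"
    using ex_has_least_nat[of "\<lambda>q. q \<noteq> 0 \<and> eval2 q b = 0" q0 degree] assms(2,3) by blast
  have "lead_coeff p = 1"
    using p(1) by (metis bit_not_one_iff leading_coeff_0_iff)
  then have Pp: "?P p"
    using p by blast
  have "p' = p" if "?P p'" for p'
  proof (rule ccontr)
    assume ne: "p' \<noteq> p"
    have nz: "p' \<noteq> 0"
      using that by auto
    have d: "degree p' = degree p"
      using that Pp p(1) nz by (intro antisym) auto
    have "eval2 (p' - p) b = 0"
      using that Pp by (simp add: eval2_diff[OF assms(1)])
    then have "degree p \<le> degree (p' - p)"
      using p(3) ne by simp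
    moreover have "degree (p' - p) < degree p"
    proof (rule degree_lessI)
      show "\<forall>k\<ge>degree p. coeff (p' - p) k = 0"
      proof (intro allI impI)
        fix k assume "degree p \<le> k"
        then consider "k = degree p" | "k > degree p" by linarith
        then show "coeff (p' - p) k = 0"
        proof cases
          case 1
          then show ?thesis using that Pp d by simp
        next
          case 2
          then show ?thesis using d by (simp add: coeff_eq_0)
        qed
      qed
    qed (use ne in auto)
    ultimately show False
      by simp
  qed
  with Pp have "?P (THE p. ?P p)"
    by (rule theI)
  then have "?P (min_poly_F2 b)"
    unfolding min_poly_F2_def eval2_def .
  then show "lead_coeff (min_poly_F2 b) = 1" "eval2 (min_poly_F2 b) b = 0"
    "\<And>q. q \<noteq> 0 \<Longrightarrow> eval2 q b = 0 \<Longrightarrow> degree (min_poly_F2 b) \<le> degree q"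
    by blast+
qed

lemma eval2_min_poly_F2_conjugate:
  fixes b :: "'a::{field,finite}"
  assumes "card (UNIV :: 'a set) = 2 ^ m" and "CHAR('a) = 2"
  shows "eval2 (min_poly_F2 b) (b ^ (2 ^ i)) = 0"
  using ex_bit_poly_root_degree_le[OF assms, of b] min_poly_F2_props(2)[OF assms(2), of _ b]
  by (auto simp: eval2_power_2_power[OF assms(2)])

lemma min_poly_F2_nonzero:
  fixes b :: "'a::{field,finite}"
  assumes "card (UNIV :: 'a set) = 2 ^ m" and "CHAR('a) = 2"
  shows "min_poly_F2 b \<noteq> 0"
  using ex_bit_poly_root_degree_le[OF assms, of b] min_poly_F2_props(1)[OF assms(2), of _ b]
  by auto

text \<open>The pigeonhole polynomial bounds the degree from above; the \<open>m\<close> distinct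
  conjugates of \<open>b\<close>, all of them roots, bound it from below.\<close>

lemma degree_min_poly_F2:
  fixes b :: "'a::{field,finite}"
  assumes "card (UNIV :: 'a set) = 2 ^ m" and "CHAR('a) = 2"
    and inj: "inj_on (\<lambda>i. b ^ (2 ^ i)) {..<m}"
  shows "degree (min_poly_F2 b) = m"
proof (rule antisym)
  obtain q where "q \<noteq> 0" "degree q \<le> m" "eval2 q b = 0"
    using ex_bit_poly_root_degree_le[OF assms(1,2)] by blast
  then show "degree (min_poly_F2 b) \<le> m"
    using min_poly_F2_props(3)[OF assms(2), of q b q] by simp
  have "card ((\<lambda>i. b ^ (2 ^ i)) ` {..<m}) \<le> degree (min_poly_F2 b)"
    using eval2_min_poly_F2_conjugate[OF assms(1,2)]
    by (intro card_le_degree_if_eval2_eq_0 min_poly_F2_nonzero[OF assms(1,2)]) auto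
  then show "m \<le> degree (min_poly_F2 b)"
    by (simp add: card_image[OF inj])
qed

text \<open>Linear independence of geometric sequences with distinct nonzero ratios, even when only
  a tail is known.\<close>

lemma weights_eq_0_if_power_sums_eq_0:
  fixes w :: "'a::field \<Rightarrow> 'a"
  assumes fin: "finite B" and nz: "0 \<notin> B"
    and sum0: "\<And>i. i \<ge> L \<Longrightarrow> (\<Sum>b\<in>B. w b * b ^ i) = 0"
    and c: "c \<in> B"
  shows "w c = 0"
proof -
  \<comment> \<open>\<open>Q\<close> vanishes on \<open>B\<close> except at \<open>c\<close>;
    combining the power sums with its coefficients isolates the term of \<open>c\<close>.\<close>
  define Q where "Q = (\<Prod>b\<in>B-{c}. [:-b, 1:])"
  have "(\<Sum>b\<in>B. w b * b ^ L * poly Q b) = (\<Sum>b\<in>B. \<Sum>j\<le>degree Q. coeff Q j * (w b * b ^ (L + j)))"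
    by (simp add: poly_altdef sum_distrib_left power_add mult_ac)
  also have "\<dots> = (\<Sum>j\<le>degree Q. coeff Q j * (\<Sum>b\<in>B. w b * b ^ (L + j)))"
    by (subst sum.swap) (simp add: sum_distrib_left)
  also have "\<dots> = 0"
    by (simp add: sum0)
  finally have "(\<Sum>b\<in>B. w b * b ^ L * poly Q b) = 0" .
  moreover have "poly Q b = 0" if "b \<in> B - {c}" for b
    using that fin by (auto simp: Q_def poly_prod)
  ultimately have "w c * c ^ L * poly Q c = 0"
    using fin c by (simp add: sum.remove[of B c])
  moreover have "poly Q c \<noteq> 0"
    using fin by (auto simp: Q_def poly_prod)
  moreover have "c \<noteq> 0"
    using nz c by auto
  ultimately show ?thesis
    by simp
qed

section \<open>Moore determinants\<close>

text \<open>If \<open>A\<close> consists of the first three columns and \<open>B\<close> of the last two, the hypotheses say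
  \<open>A A\<^sup>T = - B B\<^sup>T\<close>, and \<open>B B\<^sup>T\<close> has rank at most 2.\<close>

lemma det3_eq_0_if_orthogonal_rows:
  fixes p1 :: "'a::field"
  assumes pp: "p1*p1 + p2*p2 + p3*p3 + p4*p4 + p5*p5 = 0"
    and qq: "q1*q1 + q2*q2 + q3*q3 + q4*q4 + q5*q5 = 0"
    and rr: "r1*r1 + r2*r2 + r3*r3 + r4*r4 + r5*r5 = 0"
    and pq: "p1*q1 + p2*q2 + p3*q3 + p4*q4 + p5*q5 = 0"
    and pr: "p1*r1 + p2*r2 + p3*r3 + p4*r4 + p5*r5 = 0"
    and qr: "q1*r1 + q2*r2 + q3*r3 + q4*r4 + q5*r5 = 0"
  shows "p1*(q2*r3 - q3*r2) - p2*(q1*r3 - q3*r1) + p3*(q1*r2 - q2*r1) = 0"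
proof -
  define gpp gqq grr gpq gpr gqr where g:
    "gpp = p1*p1 + p2*p2 + p3*p3" "gqq = q1*q1 + q2*q2 + q3*q3" "grr = r1*r1 + r2*r2 + r3*r3"
    "gpq = p1*q1 + p2*q2 + p3*q3" "gpr = p1*r1 + p2*r2 + p3*r3" "gqr = q1*r1 + q2*r2 + q3*r3"
  \<comment> \<open>The right-hand side is the determinant of the Gram matrix A A^T, hence the
    square of the determinant of A.\<close>
  have "(p1*(q2*r3 - q3*r2) - p2*(q1*r3 - q3*r1) + p3*(q1*r2 - q2*r1))\<^sup>2
      = gpp*(gqq*grr - gqr*gqr) - gpq*(gpq*grr - gqr*gpr) + gpr*(gpq*gqr - gqq*gpr)"
    unfolding g by algebra
  also have "gpp = - (p4*p4 + p5*p5)" using pp unfolding g by algebra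
  also have "gqq = - (q4*q4 + q5*q5)" using qq unfolding g by algebra
  also have "grr = - (r4*r4 + r5*r5)" using rr unfolding g by algebra
  also have "gpq = - (p4*q4 + p5*q5)" using pq unfolding g by algebra
  also have "gpr = - (p4*r4 + p5*r5)" using pr unfolding g by algebra
  also have "gqr = - (q4*r4 + q5*r5)" using qr unfolding g by algebra
  finally have "(p1*(q2*r3 - q3*r2) - p2*(q1*r3 - q3*r1) + p3*(q1*r2 - q2*r1))\<^sup>2 = 0"
    by (simp add: algebra_simps)
  then show ?thesis
    by simp
qed

text \<open>The expression in \<open>det\<close> is the Moore determinant of \<open>a\<close>,
  \<open>b\<close>, \<open>c\<close> for \<open>\<sigma>\<close>. It vanishes only if the three are
  linearly dependent over the fixed points of \<open>\<sigma>\<close>, which lie in {0, 1}.\<close>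

lemma Moore_det3_eq_0_imp:
  fixes \<sigma> :: "'a::field \<Rightarrow> 'a"
  assumes char2: "CHAR('a) = 2"
    and add: "\<And>x y. \<sigma> (x + y) = \<sigma> x + \<sigma> y" and mult: "\<And>x y. \<sigma> (x * y) = \<sigma> x * \<sigma> y"
    and \<sigma>0: "\<And>x. x \<noteq> 0 \<Longrightarrow> \<sigma> x \<noteq> 0"
    and fixed: "\<And>x. \<sigma> x = x \<Longrightarrow> x = 0 \<or> x = 1"
    and "a \<noteq> 0" "b \<noteq> 0" "a \<noteq> b"
    and det: "a*(\<sigma> b*\<sigma> (\<sigma> c) - \<sigma> c*\<sigma> (\<sigma> b)) - b*(\<sigma> a*\<sigma> (\<sigma> c) - \<sigma> c*\<sigma> (\<sigma> a))
       + c*(\<sigma> a*\<sigma> (\<sigma> b) - \<sigma> b*\<sigma> (\<sigma> a)) = 0"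
  shows "c = 0 \<or> c = a \<or> c = b \<or> c = a + b"
proof -
  define y z where "y = b / a" and "z = c / a"
  have b: "b = a * y" and c: "c = a * z"
    using \<open>a \<noteq> 0\<close> by (simp_all add: y_def z_def)
  define Y Z where "Y = \<sigma> y + y" and "Z = \<sigma> z + z"
  note minus = minus_CHAR_2[OF char2]
  have "(2::'a) = 0"
    using add_self_CHAR_2[OF char2, of 1] by simp
  \<comment> \<open>Scaling by \<open>a\<close> leaves the Moore determinant of 1, \<open>y\<close>,
    \<open>z\<close>; subtracting adjacent columns shrinks it to a 2 by 2 determinant in
    \<open>Y\<close> and \<open>Z\<close>.\<close>
  have "a * \<sigma> a * \<sigma> (\<sigma> a) * (Y * \<sigma> Z - Z * \<sigma> Y) = 0"
    using det unfolding b c mult Y_def Z_def add minus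
    by (simp add: algebra_simps \<open>2 = 0\<close>)
  then have "Y * \<sigma> Z = Z * \<sigma> Y"
    using \<open>a \<noteq> 0\<close> \<sigma>0 by simp
  moreover have "Y \<noteq> 0"
  proof
    assume "Y = 0"
    then have "\<sigma> y = y"
      by (simp add: Y_def add_eq_0_iff_CHAR_2[OF char2])
    then show False
      using fixed[of y] b \<open>b \<noteq> 0\<close> \<open>a \<noteq> b\<close> by auto
  qed
  ultimately have "\<sigma> (Z / Y) = Z / Y"
    using mult[of "Z / Y" Y] \<sigma>0[of Y] by (simp add: field_simps)
  then have "Z / Y = 0 \<or> Z / Y = 1"
    by (rule fixed)
  then have "Z = 0 \<or> Z = Y"
    using \<open>Y \<noteq> 0\<close> by auto
  then show ?thesis
  proof
    assume "Z = 0"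
    then have "\<sigma> z = z"
      by (simp add: Z_def add_eq_0_iff_CHAR_2[OF char2])
    then show ?thesis
      using fixed[of z] c by auto
  next
    assume "Z = Y"
    then have "Z + Y = 0"
      by (simp add: add_self_CHAR_2[OF char2])
    then have "\<sigma> (z + y) + (z + y) = 0"
      by (simp add: Z_def Y_def add algebra_simps)
    then have "\<sigma> (z + y) = z + y"
      by (simp add: add_eq_0_iff_CHAR_2[OF char2])
    then have "z + y = 0 \<or> z + y = 1"
      by (rule fixed)
    then have "z = y \<or> z = 1 + y"
      using add_self_CHAR_2[OF char2, of y] by (metis add.assoc add.right_neutral add_eq_0_iff_CHAR_2[OF char2])
    then show ?thesis
      using b c by (auto simp: algebra_simps)
  qed
qed

section \<open>The absolute trace\<close>

lemma trace2_add:
  fixes x y :: "'a::field"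
  assumes "CHAR('a) = 2"
  shows "trace2 m (x + y) = trace2 m x + trace2 m y"
  by (simp add: trace2_def power_2_power_add[OF assms] sum.distrib)

text \<open>Squaring shifts the summands of the trace by one place, and
  \<open>x ^ (2 ^ m) = x\<close> closes the cycle.\<close>

lemma trace2_square:
  fixes x :: "'a::field"
  assumes "x ^ (2 ^ m) = x"
  shows "trace2 m (x ^ 2) = trace2 m x"
proof -
  have "x + trace2 m (x ^ 2) = (\<Sum>i<Suc m. x ^ (2 ^ i))"
    by (subst sum.lessThan_Suc_shift) (simp add: trace2_def flip: power_mult)
  also have "\<dots> = x + trace2 m x"
    by (simp add: trace2_def assms)
  finally show ?thesis
    by simp
qed

lemma trace2_power_2_power:
  fixes x :: "'a::field"
  assumes "\<And>x::'a. x ^ (2 ^ m) = x"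
  shows "trace2 m (x ^ (2 ^ k)) = trace2 m x"
  by (induction k) (simp_all add: trace2_square[OF assms] power_mult mult.commute[of 2])

text \<open>The trace is fixed by squaring, hence a root of X^2 - X. So the test against 0 in
  \<open>trace_seq\<close> loses no information.\<close>

lemma trace2_cases:
  fixes x :: "'a::field"
  assumes "CHAR('a) = 2" and "x ^ (2 ^ m) = x"
  shows "trace2 m x = 0 \<or> trace2 m x = 1"
proof -
  have "trace2 m x ^ 2 = trace2 m (x ^ 2)"
    unfolding trace2_def using power_2_power_sum[OF assms(1), of "\<lambda>i. x ^ (2 ^ i)" "{..<m}" 1]
    by (simp add: mult.commute flip: power_mult)
  then have "trace2 m x * (trace2 m x - 1) = 0"
    unfolding trace2_square[OF assms(2)] by (simp add: power2_eq_square right_diff_distrib)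
  then show ?thesis
    by simp
qed

section \<open>The field and its primitive element\<close>

locale odd_binary_field =
  fixes \<alpha> :: "'a::{field,finite}" and m h :: nat
  assumes card_UNIV: "card (UNIV :: 'a set) = 2 ^ m"
    and m_eq: "m = 2 * h + 1" and h_ge: "h \<ge> 2"
    and primitive: "primitive_elem \<alpha>"
begin

lemma CHAR_2: "CHAR('a) = 2"
  using CHAR_2_if_card_eq_power_2[OF card_UNIV] by (simp add: m_eq)

lemmas add_self = add_self_CHAR_2[OF CHAR_2]
  and add_eq_0_iff_eq = add_eq_0_iff_CHAR_2[OF CHAR_2]

lemma power_2_m: "x ^ (2 ^ m) = (x::'a)"
proof (cases "x = 0")
  case False
  have "x ^ (2 ^ m) = x * x ^ (2 ^ m - 1)"
    by (metis power_eq_if power_not_zero zero_neq_numeral)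
  then show ?thesis
    using finite_field_power_card[OF False] by (simp add: card_UNIV)
qed simp

definition N :: nat where "N = 2 ^ m - 1"

lemma sixteen_le_pow: "(16::nat) \<le> 2 ^ (2 * h)"
  using power_increasing[of 4 "2 * h" "2::nat"] h_ge by simp

lemma pow_2h: "(2::nat) ^ (2 * h) = 2 ^ h * 2 ^ h"
  by (simp add: mult_2 power_add)

lemma four_le_pow: "(4::nat) \<le> 2 ^ h"
  using power_increasing[of 2 h "2::nat"] h_ge by simp

lemma N_eq: "N = 2 * 2 ^ (2 * h) - 1" and N_ge: "N \<ge> 31"
  unfolding N_def using sixteen_le_pow by (simp_all add: m_eq)

lemma alpha_nonzero [simp]: "\<alpha> \<noteq> 0"
  using primitive by (simp add: primitive_elem_def)

lemma alpha_power_N: "\<alpha> ^ N = 1"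
  using finite_field_power_card[of \<alpha>] by (simp add: card_UNIV N_def)

lemma alpha_power_mod: "\<alpha> ^ (k mod N) = \<alpha> ^ k"
proof -
  have "\<alpha> ^ k = \<alpha> ^ (N * (k div N) + k mod N)"
    by simp
  also have "\<dots> = \<alpha> ^ (k mod N)"
    by (simp only: power_add power_mult alpha_power_N power_one mult_1_left)
  finally show ?thesis ..
qed

lemma alpha_powers: "(\<lambda>k. \<alpha> ^ k) ` {..<N} = UNIV - {0}"
proof (intro set_eqI iffI)
  fix x :: 'a assume "x \<in> UNIV - {0}"
  then obtain k where "x = \<alpha> ^ k"
    using primitive by (auto simp: primitive_elem_def)
  then have "x = \<alpha> ^ (k mod N)"
    by (simp add: alpha_power_mod)
  then show "x \<in> (\<lambda>k. \<alpha> ^ k) ` {..<N}"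
    using N_ge by (intro image_eqI) auto
qed auto

lemma inj_on_alpha_power: "inj_on (\<lambda>k. \<alpha> ^ k) {..<N}"
proof (rule eq_card_imp_inj_on)
  show "card ((\<lambda>k. \<alpha> ^ k) ` {..<N}) = card {..<N}"
    unfolding alpha_powers by (simp add: card_UNIV card_Diff_singleton N_def)
qed simp

lemma alpha_power_eq_iff: "i < N \<Longrightarrow> j < N \<Longrightarrow> \<alpha> ^ i = \<alpha> ^ j \<longleftrightarrow> i = j"
  using inj_on_alpha_power by (auto simp: inj_on_def)

section \<open>Cyclotomic cosets of the exponents 1, 3 and 2^h + 1\<close>

definition exps :: "nat set" where "exps = {1, 3, 2 ^ h + 1}"

lemma exps_props: "e \<in> exps \<Longrightarrow> 0 < e" "e \<in> exps \<Longrightarrow> odd e" "e \<in> exps \<Longrightarrow> e \<le> 2 ^ h + 1"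
  using h_ge four_le_pow by (auto simp: exps_def)

lemma pow_h_less: "2 ^ h + 1 < (2 ^ (2 * h) :: nat)"
proof -
  have "4 * 2 ^ h \<le> (2::nat) ^ h * 2 ^ h" using four_le_pow by (intro mult_right_mono) auto
  then show ?thesis using four_le_pow pow_2h by linarith
qed

lemma exps_less_N: "e \<in> exps \<Longrightarrow> e < N"
  using exps_props(3)[of e] pow_h_less N_eq by linarith

text \<open>Doubling an exponent modulo \<open>N\<close> rotates its \<open>m\<close> binary digits.
  A rotation of \<open>e\<close> that equals \<open>e'\<close> must be odd and at most
  \<open>2 ^ h + 1\<close>, which rules out every \<open>k > 0\<close>.\<close>

lemma alpha_power_exps_eq:
  assumes e: "e \<in> exps" and e': "e' \<in> exps" and k: "k < m" and eq: "\<alpha> ^ (e * 2 ^ k) = \<alpha> ^ e'"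
  shows "e = e' \<and> k = 0"
proof -
  have small: "e = e' \<and> k = 0" if "e * 2 ^ k < N"
  proof -
    have *: "e * 2 ^ k = e'"
      using alpha_power_eq_iff[OF that exps_less_N[OF e']] eq by simp
    then have "k = 0"
      using exps_props(2)[OF e'] by (cases k) auto
    then show ?thesis
      using * by simp
  qed
  \<comment> \<open>For exponents whose leading digit wraps round: the exponent is replaced by its
    residue \<open>r\<close> modulo \<open>N\<close>.\<close>
  have red: "r = e'" if "e * 2 ^ k = r + N * q" "r < N" for r q
  proof -
    have "\<alpha> ^ r = \<alpha> ^ e'"
      using eq unfolding that(1) by (simp only: power_add power_mult alpha_power_N power_one mult_1_right)
    then show ?thesis
      using alpha_power_eq_iff[OF that(2) exps_less_N[OF e']] by simp
  qed
  have le: "(2::nat) ^ k \<le> 2 ^ (2 * h)"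
    using k by (intro power_increasing) (auto simp: m_eq)
  have "k < 2 * h \<or> k = 2 * h" "k \<le> h \<or> k > h"
    using k m_eq by linarith+
  then consider "e = 1" | "e = 3" "k < 2 * h" | "e = 3" "k = 2 * h" | "e = 2 ^ h + 1" "k \<le> h"
    | "e = 2 ^ h + 1" "k > h"
    using e unfolding exps_def by blast
  then show ?thesis
  proof cases
    case 1
    have "2 ^ k < N" using le N_eq sixteen_le_pow by linarith
    then show ?thesis using 1 by (intro small) simp
  next
    case 2
    then have "(2::nat) ^ Suc k \<le> 2 ^ (2 * h)" by (intro power_increasing) auto
    then show ?thesis using 2 N_eq sixteen_le_pow by (intro small) simp
  next
    case 3
    \<comment> \<open>Here \<open>3 * 2 ^ (2 * h) = (2 ^ (2 * h) + 1) + N\<close>.\<close>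
    have "2 ^ (2 * h) + 1 = e'"
      using 3 sixteen_le_pow N_eq by (intro red[of _ 1]) simp_all
    then show ?thesis
      using exps_props(3)[OF e'] pow_h_less by simp
  next
    case 4
    then have "(2::nat) ^ k \<le> 2 ^ h" by (intro power_increasing) auto
    then have "e * 2 ^ k \<le> (2 ^ h + 1) * 2 ^ h" using 4 by (intro mult_mono) auto
    also have "\<dots> = 2 ^ (2 * h) + 2 ^ h" unfolding pow_2h by (simp add: algebra_simps)
    also have "\<dots> < N" using pow_h_less N_eq by linarith
    finally show ?thesis by (rule small)
  next
    case 5
    then obtain j where j: "k = h + 1 + j"
      by (metis Suc_eq_plus1 Suc_leI le_Suc_ex)
    then have "j < h" using k m_eq by simp
    have p: "e * 2 ^ k = 2 ^ j + 2 ^ k + N * 2 ^ j"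
    proof -
      \<comment> \<open>The leading term \<open>2 ^ (h + k)\<close> is \<open>2 ^ (m + j)\<close>,
        which wraps round to \<open>2 ^ j\<close>.\<close>
      have "h + k = m + j"
        by (simp add: j m_eq)
      then have "(2::nat) ^ h * 2 ^ k = 2 ^ m * 2 ^ j"
        by (metis power_add)
      then have "e * 2 ^ k = 2 ^ m * 2 ^ j + 2 ^ k"
        using 5 by (simp only: distrib_right mult_1_left)
      also have "2 ^ m = N + (1::nat)"
        by (simp add: N_def)
      finally show ?thesis by (simp add: algebra_simps)
    qed
    have "(2::nat) ^ j \<le> 2 ^ h" using \<open>j < h\<close> by (intro power_increasing) auto
    then have *: "2 ^ j + 2 ^ k = e'"
      using le pow_h_less N_eq by (intro red[OF p]) linarith
    have "j = 0"
      using * exps_props(2)[OF e'] j by (cases j) auto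
    then have "1 + 2 * 2 ^ h = e'" using * j by simp
    then show ?thesis
      using exps_props(3)[OF e'] four_le_pow by simp
  qed
qed

text \<open>The three cosets are disjoint and of full size \<open>m\<close>. Cancelling the smaller
  Frobenius power, which is injective, reduces this to \<open>alpha_power_exps_eq\<close>.\<close>

lemma inj_on_conjugates: "inj_on (\<lambda>(e, i). \<alpha> ^ (e * 2 ^ i)) (exps \<times> {..<m})"
proof -
  have *: "e = e' \<and> i = i'"
    if "e \<in> exps" "e' \<in> exps" "i < m" "i' \<le> i" and eq: "\<alpha> ^ (e * 2 ^ i) = \<alpha> ^ (e' * 2 ^ i')" for e e' i i'
  proof -
    have "(\<alpha> ^ (e * 2 ^ (i - i'))) ^ (2 ^ i') = (\<alpha> ^ e') ^ (2 ^ i')"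
      using that by (simp flip: power_mult power_add add: mult.assoc)
    then have "\<alpha> ^ (e * 2 ^ (i - i')) = \<alpha> ^ e'"
      by (rule power_2_power_inj[OF CHAR_2])
    then have "e = e' \<and> i - i' = 0"
      using that by (intro alpha_power_exps_eq) auto
    then show ?thesis using that(4) by simp
  qed
  show ?thesis
  proof (rule inj_onI, clarsimp)
    fix e i e' i' assume a: "e \<in> exps" "i < m" "e' \<in> exps" "i' < m" "\<alpha> ^ (e * 2 ^ i) = \<alpha> ^ (e' * 2 ^ i')"
    then show "e = e' \<and> i = i'"
      using *[of e e' i i'] *[of e' e i' i] by (metis nle_le)
  qed
qed

lemma conjugate_neq_1: "e \<in> exps \<Longrightarrow> \<alpha> ^ (e * 2 ^ i) \<noteq> 1"
proof
  assume e: "e \<in> exps" and "\<alpha> ^ (e * 2 ^ i) = 1"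
  then have "(\<alpha> ^ e) ^ (2 ^ i) = 1 ^ (2 ^ i)"
    by (simp add: power_mult)
  then have "\<alpha> ^ e = \<alpha> ^ 0"
    using power_2_power_inj[OF CHAR_2] by (metis power_0)
  then show False
    using alpha_power_eq_iff[OF exps_less_N[OF e], of 0] N_ge exps_props(1)[OF e] by simp
qed

text \<open>The ratios of the geometric sequences that add up to the trace sequence; their inverses
  are the roots of \<open>gen_poly\<close>.\<close>

definition ratios :: "'a set" where
  "ratios = insert 1 ((\<lambda>(e, i). \<alpha> ^ (e * 2 ^ i)) ` (exps \<times> {..<m}))"

lemma zero_notin_ratios: "0 \<notin> ratios"
  by (auto simp: ratios_def)

lemma card_exps: "card exps = 3"
  using h_ge four_le_pow by (simp add: exps_def)

lemma finite_exps [simp]: "finite exps"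
  by (simp add: exps_def)

lemma one_notin_conjugates: "1 \<notin> (\<lambda>(e, i). \<alpha> ^ (e * 2 ^ i)) ` (exps \<times> {..<m})"
  using conjugate_neq_1 by (auto simp: eq_commute[of 1])

lemma card_ratios: "card ratios = 3 * m + 1"
  unfolding ratios_def using one_notin_conjugates
  by (simp add: card_image[OF inj_on_conjugates] card_cartesian_product card_exps)

lemma card_inverse_ratios: "card (inverse ` ratios) = 3 * m + 1"
proof -
  have "inj_on inverse ratios"
    by (rule inj_onI) simp
  then show ?thesis
    by (simp add: card_image card_ratios)
qed

lemma sum_ratios: "(\<Sum>b\<in>ratios. b ^ t) = 1 + (\<Sum>e\<in>exps. trace2 m (\<alpha> ^ (e * t)))"
proof -
  have "(\<Sum>b\<in>ratios. b ^ t) = 1 + (\<Sum>(e, i)\<in>exps \<times> {..<m}. (\<alpha> ^ (e * 2 ^ i)) ^ t)"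
    unfolding ratios_def
    by (subst sum.insert[OF _ one_notin_conjugates], simp, subst sum.reindex[OF inj_on_conjugates])
      (simp add: case_prod_unfold o_def)
  also have "\<dots> = 1 + (\<Sum>e\<in>exps. trace2 m (\<alpha> ^ (e * t)))"
    by (simp add: sum.cartesian_product[symmetric] trace2_def mult_ac flip: power_mult)
  finally show ?thesis .
qed

section \<open>The generator polynomial\<close>

definition x_minus_1 :: "bit poly" where "x_minus_1 = [:-1, 1:]"

lemma x_minus_1_nonzero: "x_minus_1 \<noteq> 0" and degree_x_minus_1: "degree x_minus_1 = 1" and eval2_x_minus_1: "eval2 x_minus_1 (1::'a) = 0"
  using add_self[of 1] by (simp_all add: x_minus_1_def eval2_altdef)

definition gen_poly :: "bit poly" where
  "gen_poly = x_minus_1 * min_poly_F2 (inverse \<alpha>) * min_poly_F2 (inverse (\<alpha> ^ 3))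
             * min_poly_F2 (inverse (\<alpha> ^ (2 ^ h + 1)))"

lemma gen_poly_eq: "gen_poly = x_minus_1 * (\<Prod>e\<in>exps. min_poly_F2 (inverse (\<alpha> ^ e)))"
  using h_ge four_le_pow by (simp add: gen_poly_def exps_def mult.assoc)

lemma degree_min_poly_F2_exps:
  assumes "e \<in> exps"
  shows "degree (min_poly_F2 (inverse (\<alpha> ^ e))) = m"
proof (rule degree_min_poly_F2[OF card_UNIV CHAR_2], rule inj_onI)
  fix i j assume "i \<in> {..<m}" "j \<in> {..<m}" "inverse (\<alpha> ^ e) ^ 2 ^ i = inverse (\<alpha> ^ e) ^ 2 ^ j"
  then show "i = j"
    using inj_onD[OF inj_on_conjugates, of "(e, i)" "(e, j)"] assms
    by (simp add: power_inverse flip: power_mult)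
qed

lemma degree_gen_poly: "degree gen_poly = 3 * m + 1" and gen_poly_nonzero: "gen_poly \<noteq> 0"
proof -
  note nz = min_poly_F2_nonzero[OF card_UNIV CHAR_2]
  show "gen_poly \<noteq> 0"
    unfolding gen_poly_eq by (simp add: nz x_minus_1_nonzero)
  have "degree (\<Prod>e\<in>exps. min_poly_F2 (inverse (\<alpha> ^ e))) = (\<Sum>e\<in>exps. m)"
    by (subst degree_prod_eq_sum_degree) (simp_all add: nz degree_min_poly_F2_exps)
  then show "degree gen_poly = 3 * m + 1"
    unfolding gen_poly_eq by (subst degree_mult_eq) (simp_all add: nz card_exps x_minus_1_nonzero degree_x_minus_1)
qed

text \<open>The inverses of the ratios are \<open>3 * m + 1\<close> distinct roots of
  \<open>gen_poly\<close>, as many as its degree. A nonzero remainder modulo \<open>gen_poly\<close>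
  would have more roots than its degree allows.\<close>

lemma gen_poly_dvd_iff:
  "gen_poly dvd q \<longleftrightarrow> (\<forall>b\<in>ratios. eval2 q (inverse b) = 0)"
proof
  note mult = eval2_mult[OF CHAR_2]
  have P0: "eval2 gen_poly (inverse b) = 0" if "b \<in> ratios" for b
  proof (cases "b = 1")
    case True
    then show ?thesis by (simp add: gen_poly_def mult eval2_x_minus_1)
  next
    case False
    then obtain e i where e: "e \<in> exps" "b = \<alpha> ^ (e * 2 ^ i)"
      using \<open>b \<in> ratios\<close> by (auto simp: ratios_def)
    have "min_poly_F2 (inverse (\<alpha> ^ e)) dvd gen_poly"
      unfolding gen_poly_eq using e(1) by (intro dvd_mult dvd_prodI) auto
    moreover have "inverse b = inverse (\<alpha> ^ e) ^ (2 ^ i)"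
      by (simp add: e power_inverse power_mult)
    ultimately show ?thesis
      using eval2_min_poly_F2_conjugate[OF card_UNIV CHAR_2] by (auto simp: mult elim!: dvdE)
  qed
  show "\<forall>b\<in>ratios. eval2 q (inverse b) = 0" if "gen_poly dvd q"
    using that P0 by (auto simp: mult elim!: dvdE)
  show "gen_poly dvd q" if q: "\<forall>b\<in>ratios. eval2 q (inverse b) = 0"
  proof (rule ccontr)
    assume "\<not> gen_poly dvd q"
    then have r: "q mod gen_poly \<noteq> 0"
      by (simp add: dvd_eq_mod_eq_0)
    have "eval2 (q mod gen_poly) (inverse b) = 0" if "b \<in> ratios" for b
    proof -
      have "eval2 q (inverse b) = eval2 (q div gen_poly * gen_poly + q mod gen_poly) (inverse b)"
        by (simp only: div_mult_mod_eq)
      also have "\<dots> = eval2 (q mod gen_poly) (inverse b)"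
        by (simp only: eval2_add[OF CHAR_2] mult P0[OF that] mult_zero_right add_0)
      finally show ?thesis
        using q that by simp
    qed
    then have "card (inverse ` ratios) \<le> degree (q mod gen_poly)"
      by (intro card_le_degree_if_eval2_eq_0 r) auto
    then show False
      using card_inverse_ratios degree_mod_less[OF gen_poly_nonzero, of q] r degree_gen_poly by simp
  qed
qed

text \<open>Roots are closed under conjugation, so one representative per coset suffices.\<close>

lemma gen_poly_dvd_iff_exps:
  "gen_poly dvd q \<longleftrightarrow> eval2 q (1::'a) = 0 \<and> (\<forall>e\<in>exps. eval2 q (inverse (\<alpha> ^ e)) = 0)"
proof -
  have "eval2 q (inverse (\<alpha> ^ (e * 2 ^ i))) = eval2 q (inverse (\<alpha> ^ e)) ^ (2 ^ i)" for e i
    by (simp add: power_mult power_inverse flip: eval2_power_2_power[OF CHAR_2])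
  moreover have "0 < m"
    by (simp add: m_eq)
  ultimately show ?thesis
    by (auto simp: gen_poly_dvd_iff ratios_def)
qed

text \<open>\<open>seq_annihilates\<close> demands constant term 1. Otherwise 0 would be a further
  root, one more than the degree allows.\<close>

lemma coeff_gen_poly_0: "coeff gen_poly 0 = 1"
proof (rule ccontr)
  assume "coeff gen_poly 0 \<noteq> 1"
  then have "eval2 gen_poly 0 = (0::'a)"
    by (simp add: eval2_def poly_0_coeff_0)
  moreover have "\<forall>b\<in>ratios. eval2 gen_poly (inverse b) = 0"
    using gen_poly_dvd_iff[of gen_poly] by simp
  ultimately have "card (insert 0 (inverse ` ratios)) \<le> degree gen_poly"
    by (intro card_le_degree_if_eval2_eq_0 gen_poly_nonzero) auto
  moreover have "0 \<notin> inverse ` ratios"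
    using zero_notin_ratios by auto
  ultimately show False
    by (simp add: card_inverse_ratios degree_gen_poly)
qed

section \<open>The sequence\<close>

text \<open>Since \<open>(2 ^ h + 1) * 2 ^ (h + 1) = 2 ^ m + 2 ^ (h + 1)\<close>, the exponents
  \<open>2 ^ h + 1\<close> and \<open>2 ^ (h + 1) + 1\<close> are conjugate. Hence the smaller one
  can stand in \<open>exps\<close>.\<close>

lemma power_conjugate: "(x ^ (2 ^ h + 1)) ^ (2 ^ (h + 1)) = x * (x::'a) ^ (2 ^ (h + 1))"
proof -
  have "(2::nat) ^ m = 2 * (2 ^ h * 2 ^ h)"
    by (simp add: m_eq pow_2h)
  then have "(2 ^ h + 1) * 2 ^ (h + 1) = (2 ^ m + 2 ^ (h + 1) :: nat)"
    by (simp add: algebra_simps)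
  then have "(x ^ (2 ^ h + 1)) ^ (2 ^ (h + 1)) = x ^ (2 ^ m) * x ^ (2 ^ (h + 1))"
    by (metis power_add power_mult)
  then show ?thesis
    by (simp only: power_2_m)
qed

definition seq :: "nat \<Rightarrow> bit" where
  "seq = trace_seq m (\<lambda>x. x + x ^ 3 + x ^ (2 ^ (h + 1) + 1)) \<alpha>"

text \<open>After expansion \<open>x\<close>, \<open>x ^ 2\<close> and
  \<open>x ^ (2 ^ (h + 1))\<close> have the same trace, and of three equal terms one survives in
  characteristic 2.\<close>

lemma trace2_f3:
  "trace2 m ((x + 1) + (x + 1) ^ 3 + (x + 1) ^ (2 ^ (h + 1) + 1))
    = 1 + (\<Sum>e\<in>exps. trace2 m ((x::'a) ^ e))"
proof -
  note tr_add = trace2_add[OF CHAR_2] and tr_pow = trace2_power_2_power[OF power_2_m]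
  have "(x + 1) ^ (2 ^ (h + 1)) = x ^ (2 ^ (h + 1)) + 1"
    using power_2_power_add[OF CHAR_2, of x 1 "h + 1"] by (simp only: power_one)
  then have pow: "(x + 1) ^ (2 ^ (h + 1) + 1) = (x ^ (2 ^ (h + 1)) + 1) * (x + 1)"
    by (simp only: power_add[of "x + 1" "2 ^ (h + 1)" 1] power_one_right)
  have "(x + 1) ^ 3 = (x + 1) ^ (2 ^ 1) * (x + 1)"
    by (simp add: power3_eq_cube power2_eq_square)
  also have "(x + 1) ^ (2 ^ 1) = x ^ 2 + 1"
    by (subst power_2_power_add[OF CHAR_2]) simp
  finally have "(x + 1) + (x + 1) ^ 3 + (x + 1) ^ (2 ^ (h + 1) + 1)
      = x + 1 + (x ^ 2 + 1) * (x + 1) + (x ^ (2 ^ (h + 1)) + 1) * (x + 1)"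
    by (simp only: pow)
  also have "\<dots> = x ^ 2 + x ^ 3 + x ^ (2 ^ (h + 1)) * x + x ^ (2 ^ (h + 1)) + x + 1 + (x + x + (1 + 1))"
    by (simp add: algebra_simps power2_eq_square power3_eq_cube)
  also have "x + x + (1 + 1) = 0"
    by (simp only: add_self add_0)
  finally have eq: "(x + 1) + (x + 1) ^ 3 + (x + 1) ^ (2 ^ (h + 1) + 1)
      = x ^ 2 + x ^ 3 + x ^ (2 ^ (h + 1)) * x + x ^ (2 ^ (h + 1)) + x + 1"
    by (simp only: add_0_right)
  have "trace2 m (x ^ 2) = trace2 m x"
    using tr_pow[of x 1] by simp
  \<comment> \<open>The trace of 1 is a sum of \<open>m\<close> ones, and \<open>m\<close> is
    odd.\<close>
  moreover have "trace2 m 1 = (1 :: 'a)"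
    using add_self[of 1] by (simp add: trace2_def m_eq)
  moreover have "trace2 m (x ^ (2 ^ (h + 1)) * x) = trace2 m (x ^ (2 ^ h + 1))"
    using tr_pow[of "x ^ (2 ^ h + 1)" "h + 1"] unfolding power_conjugate by (simp only: mult.commute)
  moreover have "(\<Sum>e\<in>exps. trace2 m (x ^ e)) = trace2 m x + trace2 m (x ^ 3) + trace2 m (x ^ (2 ^ h + 1))"
    using four_le_pow by (simp add: exps_def)
  moreover have "a + b + c + a + a + 1 = 1 + (a + b + c)" for a b c :: 'a
  proof -
    have "a + b + c + a + a + 1 = 1 + (a + b + c) + (a + a)"
      by (simp add: algebra_simps)
    then show ?thesis
      by (simp only: add_self add_0_right)
  qed
  ultimately show ?thesis
    unfolding eq tr_add tr_pow by (simp only:)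
qed

lemma embed_seq: "embed_bit (seq t) = (\<Sum>b\<in>ratios. b ^ t)"
proof -
  let ?T = "trace2 m ((\<alpha> ^ t + 1) + (\<alpha> ^ t + 1) ^ 3 + (\<alpha> ^ t + 1) ^ (2 ^ (h + 1) + 1))"
  have "embed_bit (seq t) = ?T"
    using trace2_cases[OF CHAR_2 power_2_m] by (auto simp: seq_def trace_seq_def)
  also have "\<dots> = (\<Sum>b\<in>ratios. b ^ t)"
    unfolding trace2_f3 sum_ratios by (simp add: mult.commute flip: power_mult)
  finally show ?thesis .
qed

text \<open>The recurrence for \<open>q\<close> at index \<open>i\<close> is an exponential sum over
  \<open>ratios\<close> with weights \<open>eval2 q (inverse b)\<close>. By linear independence it
  vanishes for all \<open>i \<ge> degree q\<close> iff all weights are 0.\<close>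

lemma seq_annihilates_iff: "seq_annihilates q seq \<longleftrightarrow> coeff q 0 = 1 \<and> gen_poly dvd q"
proof -
  have *: "embed_bit (\<Sum>j\<le>degree q. coeff q j * seq (i - j))
      = (\<Sum>b\<in>ratios. eval2 q (inverse b) * b ^ i)" if "i \<ge> degree q" for i
  proof -
    have "embed_bit (\<Sum>j\<le>degree q. coeff q j * seq (i - j))
        = (\<Sum>j\<le>degree q. \<Sum>b\<in>ratios. embed_bit (coeff q j) * b ^ (i - j))"
      by (simp add: embed_bit_sum[OF CHAR_2] embed_bit_mult embed_seq sum_distrib_left
          del: mult_bit_eq_and)
    also have "\<dots> = (\<Sum>b\<in>ratios. \<Sum>j\<le>degree q. embed_bit (coeff q j) * b ^ (i - j))"
      by (rule sum.swap)
    also have "\<dots> = (\<Sum>b\<in>ratios. \<Sum>j\<le>degree q. embed_bit (coeff q j) * inverse b ^ j * b ^ i)"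
    proof (intro sum.cong refl)
      fix b j assume "b \<in> ratios" "j \<in> {..degree q}"
      \<comment> \<open>The bound \<open>j \<le> degree q \<le> i\<close> keeps the subtraction
        \<open>i - j\<close> of natural numbers exact.\<close>
      then have "b \<noteq> 0" "j \<le> i"
        using zero_notin_ratios that by auto
      then show "embed_bit (coeff q j) * b ^ (i - j) = embed_bit (coeff q j) * inverse b ^ j * b ^ i"
        by (simp add: power_diff power_inverse divide_inverse)
    qed
    finally show ?thesis
      by (simp add: eval2_altdef sum_distrib_right)
  qed
  show ?thesis
  proof
    assume q: "seq_annihilates q seq"
    have "(\<Sum>b\<in>ratios. eval2 q (inverse b) * b ^ i) = 0" if "i \<ge> degree q" for i
      using q that by (simp add: seq_annihilates_def flip: *)
    then have "eval2 q (inverse b) = 0" if "b \<in> ratios" for b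
      using weights_eq_0_if_power_sums_eq_0[OF _ zero_notin_ratios, of "degree q" "\<lambda>b. eval2 q (inverse b)"] that by simp
    then show "coeff q 0 = 1 \<and> gen_poly dvd q"
      using q by (simp add: gen_poly_dvd_iff seq_annihilates_def)
  next
    assume q: "coeff q 0 = 1 \<and> gen_poly dvd q"
    have "(\<Sum>j\<le>degree q. coeff q j * seq (i - j)) = 0" if "i \<ge> degree q" for i
    proof -
      have "embed_bit (\<Sum>j\<le>degree q. coeff q j * seq (i - j)) = (0::'a)"
        unfolding *[OF that] using q by (simp add: gen_poly_dvd_iff)
      then show ?thesis
        by (simp only: embed_bit_eq_0_iff)
    qed
    then show "seq_annihilates q seq"
      using q by (simp add: seq_annihilates_def)
  qed
qed

text \<open>Every annihilator is a multiple of \<open>gen_poly\<close>; one of least degree has a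
  nonzero constant cofactor, which over F_2 is 1.\<close>

lemma seq_min_poly_eq: "seq_min_poly seq = gen_poly"
  unfolding seq_min_poly_def
proof (rule the_equality)
  show "seq_annihilates gen_poly seq \<and> (\<forall>g'. seq_annihilates g' seq \<longrightarrow> degree gen_poly \<le> degree g')"
    by (auto simp: seq_annihilates_iff coeff_gen_poly_0 intro!: dvd_imp_degree_le)
next
  fix g assume g: "seq_annihilates g seq \<and> (\<forall>g'. seq_annihilates g' seq \<longrightarrow> degree g \<le> degree g')"
  then obtain u where u: "g = gen_poly * u" and "coeff g 0 = 1"
    by (auto simp: seq_annihilates_iff)
  moreover have "degree g \<le> degree gen_poly"
    using g by (auto simp: seq_annihilates_iff coeff_gen_poly_0)
  moreover have "u \<noteq> 0"
    using \<open>coeff g 0 = 1\<close> u by auto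
  ultimately have "degree u = 0"
    using gen_poly_nonzero by (simp add: degree_mult_eq)
  then obtain c where c: "u = [:c:]"
    by (metis degree_eq_zeroE)
  then have "c = 1" using \<open>u \<noteq> 0\<close> by auto
  then have "u = 1" using c by (simp add: one_pCons)
  then show "g = gen_poly" using u by simp
qed

section \<open>Minimum distance\<close>

text \<open>As \<open>2 * (h + 1) = m + 1\<close>, this is a square root of the squaring
  map.\<close>

definition \<sigma> :: "'a \<Rightarrow> 'a" where "\<sigma> x = x ^ (2 ^ (h + 1))"

lemma \<sigma>_add: "\<sigma> (x + y) = \<sigma> x + \<sigma> y"
  unfolding \<sigma>_def by (rule power_2_power_add[OF CHAR_2])

lemma \<sigma>_mult: "\<sigma> (x * y) = \<sigma> x * \<sigma> y"
  unfolding \<sigma>_def by (rule power_mult_distrib)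

lemma \<sigma>_sum: "\<sigma> (sum f A) = (\<Sum>i\<in>A. \<sigma> (f i))"
  unfolding \<sigma>_def by (rule power_2_power_sum[OF CHAR_2])

lemma \<sigma>_eq_0_iff: "\<sigma> x = 0 \<longleftrightarrow> x = 0"
  by (simp add: \<sigma>_def)

lemma \<sigma>_\<sigma>: "\<sigma> (\<sigma> x) = x * x"
proof -
  have "2 ^ (h + 1) * 2 ^ (h + 1) = (2 ^ m * 2 :: nat)"
    by (simp add: m_eq pow_2h)
  then have "\<sigma> (\<sigma> x) = (x ^ (2 ^ m)) ^ 2"
    unfolding \<sigma>_def by (metis power_mult)
  then show ?thesis
    by (simp only: power_2_m power2_eq_square)
qed

lemma \<sigma>_fixed:
  assumes "\<sigma> x = x"
  shows "x = 0 \<or> x = 1"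
  using \<sigma>_\<sigma>[of x] assms by simp

lemma square_add: "(x + y) * (x + y) = x * x + y * (y::'a)"
  by (simp flip: \<sigma>_\<sigma> add: \<sigma>_add)

text \<open>The cube is written \<open>x * (x * x)\<close> because \<open>x * x\<close> is
  \<open>\<sigma> (\<sigma> x)\<close>: the last two sums are inner products of the vectors of
  \<open>x\<close>, \<open>\<sigma> x\<close> and \<open>\<sigma> (\<sigma> x)\<close>.\<close>

definition balanced :: "'a set \<Rightarrow> bool" where
  "balanced S \<longleftrightarrow> (\<Sum>x\<in>S. x) = 0 \<and> (\<Sum>x\<in>S. x * \<sigma> x) = 0 \<and> (\<Sum>x\<in>S. x * (x * x)) = 0"

lemma balanced_iff_exps: "balanced S \<longleftrightarrow> (\<forall>e\<in>exps. (\<Sum>x\<in>S. x ^ e) = 0)"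
proof -
  have "(\<Sum>x\<in>S. x * \<sigma> x) = \<sigma> (\<Sum>x\<in>S. x ^ (2 ^ h + 1))"
    unfolding \<sigma>_sum unfolding \<sigma>_def power_conjugate ..
  moreover have "x * (x * x) = x ^ 3" for x :: 'a
    by (simp add: power3_eq_cube)
  ultimately show ?thesis
    by (auto simp: balanced_def exps_def \<sigma>_eq_0_iff)
qed

lemma of_nat_card_eq_0_iff: "of_nat n = (0::'a) \<longleftrightarrow> even n"
  by (simp add: of_nat_eq_0_iff_char_dvd CHAR_2)

lemma sum_translate: "sum f ((+) a ` S) = (\<Sum>x\<in>S. f (a + (x::'a)))"
  by (subst sum.reindex) (auto simp: inj_on_def)

lemma conjugate_sums_eq_0:
  assumes "(\<Sum>x\<in>S. x) = (0::'a)"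
  shows "(\<Sum>x\<in>S. \<sigma> x) = 0" "(\<Sum>x\<in>S. x * x) = 0"
proof -
  have \<sigma>0: "\<sigma> 0 = 0"
    by (simp add: \<sigma>_eq_0_iff)
  show s: "(\<Sum>x\<in>S. \<sigma> x) = 0"
    using \<sigma>_sum[of "\<lambda>x. x" S] assms \<sigma>0 by simp
  show "(\<Sum>x\<in>S. x * x) = 0"
    using \<sigma>_sum[of \<sigma> S] s \<sigma>0 by (simp add: \<sigma>_\<sigma>)
qed

lemma product_translate: "(a + x) * \<sigma> (a + x) = a * \<sigma> a + a * \<sigma> x + \<sigma> a * x + x * \<sigma> x"
  by (simp add: \<sigma>_add algebra_simps)

lemma cube_translate:
  "(a + x) * ((a + x) * (a + x)) = a * (a * a) + a * (x * x) + (a * a) * x + x * (x * (x::'a))"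
  unfolding square_add by (simp add: algebra_simps)

text \<open>In the expansions the constant terms are counted \<open>card S\<close> times, an even
  number, and the mixed terms involve only the sums of \<open>x\<close>, \<open>\<sigma> x\<close>
  and \<open>x * x\<close>, which vanish.\<close>

lemma balanced_translate:
  assumes "balanced S" "even (card S)"
  shows "balanced ((+) a ` S)"
proof -
  have n: "of_nat (card S) = (0::'a)"
    using assms(2) by (simp add: of_nat_card_eq_0_iff)
  have s: "(\<Sum>x\<in>S. x) = 0" "(\<Sum>x\<in>S. x * \<sigma> x) = 0" "(\<Sum>x\<in>S. x * (x * x)) = 0"
    using assms(1) by (auto simp: balanced_def)
  show ?thesis
    unfolding balanced_def sum_translate product_translate cube_translate sum.distrib
    by (simp add: n s conjugate_sums_eq_0[OF s(1)] flip: sum_distrib_left)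
qed

lemma balanced_Diff_0: "balanced (S - {0}) \<longleftrightarrow> balanced S"
proof -
  have "sum f (S - {0}) = sum f S" if "f 0 = 0" for f :: "'a \<Rightarrow> 'a"
    using that by (intro sum.mono_neutral_left) auto
  then show ?thesis
    by (simp add: balanced_def)
qed

section \<open>Excluding weights 2, 4 and 6\<close>

lemma not_balanced_card_1:
  assumes "card T = 1" "0 \<notin> T"
  shows "\<not> balanced T"
  using assms by (auto simp: card_1_singleton_iff balanced_def)

text \<open>With \<open>c = a + b\<close> the second sum collapses to
  \<open>a * \<sigma> b + b * \<sigma> a\<close>, so \<open>b / a\<close> is fixed by
  \<open>\<sigma>\<close> and must be 0 or 1.\<close>

lemma not_balanced_card_3:
  assumes "card T = 3" "0 \<notin> T"
  shows "\<not> balanced T"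
proof
  assume "balanced T"
  obtain a b c where T: "T = {a, b, c}" and d: "a \<noteq> b" "b \<noteq> c" "a \<noteq> c"
    using assms(1) by (auto simp: card_3_iff)
  have "a + b + c = 0" and s2: "a * \<sigma> a + b * \<sigma> b + c * \<sigma> c = 0"
    using \<open>balanced T\<close> d unfolding balanced_def T by (simp_all add: add.assoc)
  then have c: "c = a + b"
    by (simp add: add_eq_0_iff_eq)
  have "a * \<sigma> b + b * \<sigma> a + ((a * \<sigma> a + a * \<sigma> a) + (b * \<sigma> b + b * \<sigma> b)) = 0"
    using s2 unfolding c \<sigma>_add by (simp add: algebra_simps)
  then have "a * \<sigma> b = b * \<sigma> a"
    by (simp only: add_self add_0_right add_eq_0_iff_eq)
  moreover have "a \<noteq> 0" "b \<noteq> 0"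
    using assms(2) T by auto
  ultimately have "\<sigma> (b / a) = b / a"
    using \<sigma>_mult[of "b / a" a] \<sigma>_eq_0_iff[of a] by (simp add: field_simps)
  then have "b / a = 0 \<or> b / a = 1"
    by (rule \<sigma>_fixed)
  then show False
    using d \<open>a \<noteq> 0\<close> \<open>b \<noteq> 0\<close> by auto
qed

text \<open>Repeated application of \<open>\<sigma>\<close> to the three balance equations yields
  all six inner products of the rows \<open>x\<close>, \<open>\<sigma> x\<close>,
  \<open>x * x\<close>. The Moore determinant of any three of the points then vanishes.\<close>

lemma balanced_5_det:
  assumes bal: "balanced {a, b, c, d, e}" and dist: "distinct [a, b, c, d, e]" and nz: "a \<noteq> 0" "b \<noteq> 0" "c \<noteq> 0"
  shows "c = a + b"
proof -
  have p: "a + b + c + d + e = 0" and pq: "a * \<sigma> a + b * \<sigma> b + c * \<sigma> c + d * \<sigma> d + e * \<sigma> e = 0"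
    and pr: "a * (a * a) + b * (b * b) + c * (c * c) + d * (d * d) + e * (e * e) = 0"
    using bal dist unfolding balanced_def by (simp_all add: add.assoc)
  have q: "\<sigma> a + \<sigma> b + \<sigma> c + \<sigma> d + \<sigma> e = 0"
    using arg_cong[OF p, of \<sigma>] by (simp add: \<sigma>_add \<sigma>_eq_0_iff)
  have pp: "a * a + b * b + c * c + d * d + e * e = 0"
    using arg_cong[OF q, of \<sigma>] by (simp add: \<sigma>_add \<sigma>_eq_0_iff \<sigma>_\<sigma>)
  have qq: "\<sigma> a * \<sigma> a + \<sigma> b * \<sigma> b + \<sigma> c * \<sigma> c + \<sigma> d * \<sigma> d + \<sigma> e * \<sigma> e = 0"
    using arg_cong[OF pp, of \<sigma>] by (simp add: \<sigma>_add \<sigma>_eq_0_iff \<sigma>_mult)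
  have rr: "(a * a) * (a * a) + (b * b) * (b * b) + (c * c) * (c * c) + (d * d) * (d * d) + (e * e) * (e * e) = 0"
    using arg_cong[OF qq, of \<sigma>] by (simp add: \<sigma>_add \<sigma>_eq_0_iff \<sigma>_mult \<sigma>_\<sigma>)
  have qr: "\<sigma> a * (a * a) + \<sigma> b * (b * b) + \<sigma> c * (c * c) + \<sigma> d * (d * d) + \<sigma> e * (e * e) = 0"
    using arg_cong[OF pq, of \<sigma>] by (simp add: \<sigma>_add \<sigma>_eq_0_iff \<sigma>_mult \<sigma>_\<sigma>)
  have "c = 0 \<or> c = a \<or> c = b \<or> c = a + b"
  proof (rule Moore_det3_eq_0_imp[OF CHAR_2 \<sigma>_add \<sigma>_mult])
    show "a*(\<sigma> b*\<sigma> (\<sigma> c) - \<sigma> c*\<sigma> (\<sigma> b)) - b*(\<sigma> a*\<sigma> (\<sigma> c) - \<sigma> c*\<sigma> (\<sigma> a))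
       + c*(\<sigma> a*\<sigma> (\<sigma> b) - \<sigma> b*\<sigma> (\<sigma> a)) = 0"
      unfolding \<sigma>_\<sigma> by (rule det3_eq_0_if_orthogonal_rows[OF pp qq rr pq pr qr])
  qed (use nz dist \<sigma>_fixed \<sigma>_eq_0_iff in auto)
  then show ?thesis
    using nz dist by auto
qed

text \<open>The five points may be listed in any order, so both \<open>c\<close> and
  \<open>d\<close> would equal \<open>a + b\<close>.\<close>

lemma not_balanced_card_5:
  assumes "card T = 5" "0 \<notin> T"
  shows "\<not> balanced T"
proof
  assume bal: "balanced T"
  obtain xs where xs: "set xs = T" "distinct xs"
    using finite_distinct_list[of T] by auto
  then have "length xs = 5"
    using assms(1) distinct_card by metis
  then obtain a b c d e where abc: "xs = [a, b, c, d, e]"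
    by (auto simp: numeral_eq_Suc length_Suc_conv)
  have T: "T = {a, b, c, d, e}" "T = {a, b, d, c, e}"
    using xs abc by auto
  have "c = a + b"
    using bal xs assms(2) abc unfolding T(1) by (intro balanced_5_det) auto
  moreover have "d = a + b"
    using bal xs assms(2) abc unfolding T(2) by (intro balanced_5_det) auto
  ultimately show False
    using xs abc by simp
qed

lemma balanced_even_card_ge_8:
  assumes bal: "balanced S" and ev: "even (card S)" and ne: "S \<noteq> {}"
  shows "card S \<ge> 8"
proof (rule ccontr)
  assume "\<not> 8 \<le> card S"
  obtain a where a: "a \<in> S"
    using ne by blast
  \<comment> \<open>Translation by \<open>a\<close> moves \<open>a\<close> itself to 0, and removing
    0 leaves a balanced set of odd size.\<close>
  define T where "T = (+) a ` S - {0}"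
  have "0 \<in> (+) a ` S"
    using a add_self[of a] by (metis image_eqI)
  then have "card T = card S - 1"
    by (simp add: T_def card_Diff_singleton card_image)
  moreover have "card S \<noteq> 0"
    using ne by simp
  ultimately have "card T = 1 \<or> card T = 3 \<or> card T = 5"
    using ev \<open>\<not> 8 \<le> card S\<close> by presburger
  moreover have "balanced T"
    unfolding T_def balanced_Diff_0 by (rule balanced_translate[OF bal ev])
  moreover have "0 \<notin> T"
    by (simp add: T_def)
  ultimately show False
    using not_balanced_card_1 not_balanced_card_3 not_balanced_card_5 by blast
qed

text \<open>Adjoins a basis vector \<open>d\<close> to an F_2-subspace. The sum formula pairs
  \<open>x\<close> with \<open>d + x\<close>, which amounts to taking a difference in direction
  \<open>d\<close>.\<close>

lemma double_subgroup:
  fixes V :: "'a set"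
  assumes V: "\<And>x y. x \<in> V \<Longrightarrow> y \<in> V \<Longrightarrow> x + y \<in> V" and d: "d \<notin> V"
  defines "W \<equiv> V \<union> (+) d ` V"
  shows "\<And>x y. x \<in> W \<Longrightarrow> y \<in> W \<Longrightarrow> x + y \<in> W" and "card W = 2 * card V"
    and "\<And>f :: 'a \<Rightarrow> 'a. sum f W = (\<Sum>x\<in>V. f x + f (d + x))"
proof -
  have disj: "V \<inter> (+) d ` V = {}"
  proof (rule ccontr)
    assume "V \<inter> (+) d ` V \<noteq> {}"
    then obtain x where x: "x \<in> V" "d + x \<in> V" by auto
    have "d + x + x = d"
      by (simp only: add.assoc add_self add_0_right)
    then show False
      using V[OF x(2,1)] d by metis
  qed
  show "card W = 2 * card V"
    unfolding W_def using disj by (simp add: card_Un_disjoint card_image)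
  show "sum f W = (\<Sum>x\<in>V. f x + f (d + x))" for f :: "'a \<Rightarrow> 'a"
    unfolding W_def using disj by (simp add: sum.union_disjoint sum_translate sum.distrib)
  show "x + y \<in> W" if "x \<in> W" "y \<in> W" for x y
  proof -
    have "(d + u) + (d + v) = u + v" "u + (d + v) = d + (u + v)" "(d + u) + v = d + (u + v)" for u v
      using add_self[of d] by (simp_all add: algebra_simps)
    moreover have "x \<in> V \<or> (\<exists>u\<in>V. x = d + u)" "y \<in> V \<or> (\<exists>u\<in>V. y = d + u)"
      using that by (auto simp: W_def)
    ultimately have "x + y \<in> V \<or> (\<exists>u\<in>V. x + y = d + u)"
      using V by metis
    then show ?thesis
      by (auto simp: W_def)
  qed
qed

text \<open>The witness is a coset, avoiding 0, of a subspace with 8 elements. Pairing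
  \<open>x\<close> with \<open>d + x\<close> leaves constants and multiples of \<open>x\<close>,
  \<open>\<sigma> x\<close>, \<open>x * x\<close>, whose sums over the 4-element subspace
  \<open>V2\<close> are 0.\<close>

lemma ex_balanced_card_8: "\<exists>S. balanced S \<and> card S = 8 \<and> 0 \<notin> S"
proof -
  \<comment> \<open>The field has at least 32 elements. This supplies each new basis vector and
    finally the translation \<open>a\<close>.\<close>
  have big: "\<exists>d. d \<notin> V" if "card V \<le> 8" for V :: "'a set"
  proof (rule ccontr)
    assume "\<not> ?thesis"
    then have "V = UNIV" by auto
    then show False
      using that sixteen_le_pow by (simp add: card_UNIV m_eq)
  qed
  define V0 where "V0 = {0::'a}"
  have 0: "x + y \<in> V0" if "x \<in> V0" "y \<in> V0" for x y using that by (simp add: V0_def)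
  obtain b where b: "b \<notin> V0" using big[of V0] by (auto simp: V0_def)
  define V1 where "V1 = V0 \<union> (+) b ` V0"
  note 1 = double_subgroup[OF 0 b, folded V1_def]
  have c1: "card V1 = 2" using 1(2) by (simp add: V0_def)
  obtain c where c: "c \<notin> V1" using big[of V1] c1 by auto
  define V2 where "V2 = V1 \<union> (+) c ` V1"
  note 2 = double_subgroup[OF 1(1) c, folded V2_def]
  have c2: "card V2 = 4" using 2(2) c1 by simp
  obtain d where d: "d \<notin> V2" using big[of V2] c2 by auto
  define V3 where "V3 = V2 \<union> (+) d ` V2"
  note 3 = double_subgroup[OF 2(1) d, folded V3_def]
  have c3: "card V3 = 8" using 3(2) c2 by simp
  obtain a where a: "a \<notin> V3" using big[of V3] c3 by auto
  define S where "S = (+) a ` V3"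
  have "card S = 8"
    by (simp add: S_def card_image c3)
  moreover have "0 \<notin> S"
  proof
    assume "0 \<in> S"
    then obtain x where "x \<in> V3" "a + x = 0"
      by (auto simp: S_def)
    then show False
      using a by (simp add: add_eq_0_iff_eq)
  qed
  moreover have "balanced V3"
  proof -
    have s3: "sum f V3 = (\<Sum>x\<in>V2. f x + f (d + x))" for f :: "'a \<Rightarrow> 'a"
      by (rule 3(3))
    have s2: "sum f V2 = (\<Sum>x\<in>V1. f x + f (c + x))" for f :: "'a \<Rightarrow> 'a"
      by (rule 2(3))
    have cancel: "x + (y + x) = y" "x + (y + z + w + x) = y + z + w" for x y z w :: 'a
      using add_self[of x] by (simp_all add: algebra_simps)
    have n1: "of_nat (card V1) = (0::'a)" and n2: "of_nat (card V2) = (0::'a)"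
      unfolding c1 c2 of_nat_card_eq_0_iff by simp_all
    have s: "(\<Sum>x\<in>V2. x) = 0"
      unfolding s2 cancel using n1 by simp
    show ?thesis
      unfolding balanced_def s3 product_translate cube_translate cancel sum.distrib
      using n2 by (simp add: s conjugate_sums_eq_0[OF s] flip: sum_distrib_left)
  qed
  ultimately show ?thesis
    using balanced_translate[of V3 a] c3 unfolding S_def by auto
qed

section \<open>Codewords as sets of nonzero field elements\<close>

definition points :: "bit poly \<Rightarrow> 'a set" where
  "points c = (\<lambda>i. inverse (\<alpha> ^ i)) ` {i. coeff c i \<noteq> 0}"

lemma inj_on_inverse_alpha: "inj_on (\<lambda>i. inverse (\<alpha> ^ i)) {..<N}"
  using inj_on_alpha_power by (simp add: inj_on_def)

lemma support_subset: "degree c < n \<Longrightarrow> {i. coeff c i \<noteq> 0} \<subseteq> {..<n}"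
  by (auto dest: le_degree simp del: bit_not_zero_iff)

lemma card_points: "degree c < N \<Longrightarrow> card (points c) = hweight c"
  unfolding points_def hweight_def
  by (intro card_image inj_on_subset[OF inj_on_inverse_alpha] support_subset)

text \<open>Position \<open>i\<close> is sent to \<open>inverse (\<alpha> ^ i)\<close>, so the value
  of \<open>c\<close> at \<open>inverse (\<alpha> ^ e)\<close> is the power sum of exponent
  \<open>e\<close> over \<open>points c\<close>, and the value at 1 counts the points modulo
  2.\<close>

lemma gen_poly_dvd_iff_balanced:
  assumes "degree c < N"
  shows "gen_poly dvd c \<longleftrightarrow> even (card (points c)) \<and> balanced (points c)"
proof -
  have "eval2 c (inverse (\<alpha> ^ e)) = (\<Sum>x\<in>points c. x ^ e)" for e
    unfolding eval2_eq_sum_support points_def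
    by (subst sum.reindex[OF inj_on_subset[OF inj_on_inverse_alpha support_subset[OF assms]]])
      (simp add: power_inverse mult.commute flip: power_mult)
  moreover have "eval2 c (1::'a) = of_nat (card (points c))"
    unfolding card_points[OF assms] by (simp add: eval2_eq_sum_support hweight_def)
  ultimately show ?thesis
    by (simp add: gen_poly_dvd_iff_exps balanced_iff_exps of_nat_card_eq_0_iff)
qed

lemma min_dist_code: "min_dist (cyclic_code N gen_poly) = 8"
  unfolding min_dist_def
proof (rule Min_eqI)
  have "cyclic_code N gen_poly \<subseteq> {c. degree c < N}"
    by (auto simp: cyclic_code_def)
  then show "finite (hweight ` (cyclic_code N gen_poly - {0}))"
    using finite_bit_poly_degree_less finite_subset by blast
next
  fix w assume "w \<in> hweight ` (cyclic_code N gen_poly - {0})"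
  then obtain c where c: "w = hweight c" "degree c < N" "gen_poly dvd c" "c \<noteq> 0"
    by (auto simp: cyclic_code_def)
  have "points c \<noteq> {}"
    using c(4) leading_coeff_0_iff[of c] unfolding points_def by blast
  then show "8 \<le> w"
    using c gen_poly_dvd_iff_balanced[OF c(2)] balanced_even_card_ge_8[of "points c"] card_points[OF c(2)] by simp
next
  obtain S where S: "balanced S" "card S = 8" "0 \<notin> S"
    using ex_balanced_card_8 by blast
  \<comment> \<open>The positions below \<open>N\<close> reach every nonzero element, so
    \<open>S\<close> is the point set of some word.\<close>
  have "S \<subseteq> (\<lambda>i. inverse (\<alpha> ^ i)) ` {..<N}"
  proof
    fix x assume "x \<in> S"
    then have "inverse x \<in> (\<lambda>k. \<alpha> ^ k) ` {..<N}"
      using S(3) unfolding alpha_powers by auto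
    then show "x \<in> (\<lambda>i. inverse (\<alpha> ^ i)) ` {..<N}"
      by (metis (no_types, lifting) image_iff inverse_inverse_eq)
  qed
  then obtain A where A: "A \<subseteq> {..<N}" "S = (\<lambda>i. inverse (\<alpha> ^ i)) ` A"
    by (meson subset_imageE)
  have "A \<in> (\<lambda>p :: bit poly. {i. coeff p i \<noteq> 0}) ` {p. degree p < N}"
    using bij_betw_support_bit_poly[of N] A(1) N_ge unfolding bij_betw_def by auto
  then obtain c :: "bit poly" where c: "degree c < N" "A = {i. coeff c i \<noteq> 0}"
    by blast
  then have points: "points c = S"
    unfolding points_def A(2) by simp
  then have "hweight c = 8" "gen_poly dvd c"
    using S gen_poly_dvd_iff_balanced[OF c(1)] card_points[OF c(1)] by simp_all
  moreover have "c \<noteq> 0"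
    using \<open>hweight c = 8\<close> by (auto simp: hweight_def)
  ultimately show "8 \<in> hweight ` (cyclic_code N gen_poly - {0})"
    using c(1) by (force simp: cyclic_code_def)
qed

section \<open>Dimension of the code\<close>

lemma degree_gen_poly_less: "3 * m + 1 < N"
proof -
  \<comment> \<open>The constant 2 instead of 1 pays for the subtraction in
    \<open>N = 2 ^ m - 1\<close>.\<close>
  have "3 * n + 2 < (2::nat) ^ n" if "n \<ge> 5" for n
    using that by (induction n rule: dec_induct) simp_all
  moreover have "m \<ge> 5"
    using h_ge m_eq by simp
  ultimately have "3 * m + 2 < 2 ^ m"
    by blast
  then show ?thesis
    by (simp add: N_def)
qed

text \<open>Codewords correspond to their cofactors, the binary polynomials of degree below
  \<open>N - (3 * m + 1)\<close>.\<close>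

lemma code_dim_code: "code_dim (cyclic_code N gen_poly) = N - (3 * m + 1)"
proof -
  \<comment> \<open>The zero cofactor has degree 0 by convention and is treated separately;
    \<open>degree_gen_poly_less\<close> makes the bound positive.\<close>
  have deg: "degree (gen_poly * q) < N \<longleftrightarrow> degree q < N - (3 * m + 1)" for q
    using degree_gen_poly_less by (cases "q = 0") (auto simp: degree_mult_eq gen_poly_nonzero degree_gen_poly)
  have "cyclic_code N gen_poly = (\<lambda>q. gen_poly * q) ` {q. degree q < N - (3 * m + 1)}"
    by (auto simp: cyclic_code_def deg elim!: dvdE)
  moreover have "inj_on (\<lambda>q. gen_poly * q) {q. degree q < N - (3 * m + 1)}"
    by (rule inj_onI) (simp add: gen_poly_nonzero)
  ultimately have "card (cyclic_code N gen_poly) = 2 ^ (N - (3 * m + 1))"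
    using degree_gen_poly_less by (simp add: card_image card_bit_poly_degree_less)
  then show ?thesis
    unfolding code_dim_def by simp
qed

end

theorem theorem3:
  fixes \<alpha> :: "'a::{field,finite}" and m h :: nat
  assumes "card (UNIV :: 'a set) = 2 ^ m"
    and "m = 2 * h + 1" and "m \<ge> 5"
    and "primitive_elem \<alpha>"
  defines "f3 \<equiv> (\<lambda>x::'a. x + x ^ 3 + x ^ (2 ^ (h + 1) + 1))"
  defines "s \<equiv> trace_seq m f3 \<alpha>"
  shows "seq_min_poly s =
           [:-1, 1:] * min_poly_F2 (inverse \<alpha>) * min_poly_F2 (inverse (\<alpha> ^ 3))
             * min_poly_F2 (inverse (\<alpha> ^ (2 ^ h + 1)))
       \<and> code_dim (cyclic_code (2 ^ m - 1) (seq_min_poly s)) = 2 ^ m - 2 - 3 * m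
       \<and> min_dist (cyclic_code (2 ^ m - 1) (seq_min_poly s)) = 8"
proof -
  interpret odd_binary_field \<alpha> m h
    using assms(1-4) by unfold_locales simp_all
  have "seq_min_poly s = gen_poly"
    unfolding s_def f3_def seq_def[symmetric] by (rule seq_min_poly_eq)
  moreover have "gen_poly = [:-1, 1:] * min_poly_F2 (inverse \<alpha>) * min_poly_F2 (inverse (\<alpha> ^ 3))
             * min_poly_F2 (inverse (\<alpha> ^ (2 ^ h + 1)))"
    unfolding gen_poly_def x_minus_1_def ..
  moreover have "N - (3 * m + 1) = 2 ^ m - 2 - 3 * m"
    by (simp add: N_def)
  ultimately show ?thesis
    using code_dim_code min_dist_code unfolding N_def by simp
qed

end
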